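(* Let $k$ be an even positive integer. For every integer $n>0$, let $b=\lfloor \log_2 n\rfloor$ and $c=n+1-2^{b}$. Then $$d_k(n)=\frac{(2^b+c)^k+(2^b-c)^k-(2^b+c-1)^k-(2^b-c+1)^k-2c^k+2(c-1)^k}{2^{b+1}}+d_k(c-1).$$
   Context: A P-position of the game of Nim with $k$ piles is a $k$-tuple $(p_1,\dots,p_k)$ of non-negative integers whose nim-sum $p_1\oplus\cdots\oplus p_k$ is $0$, where $\oplus$ denotes bitwise XOR. $d_k(m)$ denotes the number of P-positions with $k$ piles whose largest pile has exactly $m$ counters, for $m\ge 0$ (so $d_k(0)=1$). *)

theory Defs
  imports Complex_Main
begin

definition nim_sum :: "nat list \<Rightarrow> nat" where
  "nim_sum ps = foldr Bit_Operations.xor ps 0"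

definition P_position :: "nat list \<Rightarrow> bool" where
  "P_position ps \<longleftrightarrow> nim_sum ps = 0"

(* Positions are ordered tuples, so the order of the piles matters and empty piles are allowed.
   For k = 0 the maximum of the empty set is unspecified; the notion is only used for k > 0. *)
definition d :: "nat \<Rightarrow> nat \<Rightarrow> nat" where
  "d k m = card {ps. length ps = k \<and> P_position ps \<and> Max (set ps) = m}"

lemma finite_P_positions_Max:
  assumes "k > 0"
  shows "finite {ps. length ps = k \<and> P_position ps \<and> Max (set ps) = m}"
proof (rule finite_subset)
  show "{ps. length ps = k \<and> P_position ps \<and> Max (set ps) = m}
          \<subseteq> {ps. set ps \<subseteq> {..m} \<and> length ps = k}"
    by auto
  show "finite {ps. set ps \<subseteq> {..m} \<and> length ps = k}"
    by (rule finite_lists_length_eq) simp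
qed

lemma nim_sum_replicate_0: "nim_sum (replicate k 0) = 0"
  by (induction k) (auto simp: nim_sum_def)

lemma d_0:
  assumes "k > 0"
  shows "d k 0 = 1"
proof -
  have "{ps. length ps = k \<and> P_position ps \<and> Max (set ps) = 0} = {replicate k 0}"
  proof (intro equalityI subsetI)
    fix ps :: "nat list"
    assume "ps \<in> {ps. length ps = k \<and> P_position ps \<and> Max (set ps) = 0}"
    then have len: "length ps = k" and mx: "Max (set ps) = 0" by auto
    have "x = 0" if "x \<in> set ps" for x
      using Max_ge[OF _ that] mx by simp
    then show "ps \<in> {replicate k 0}"
      using len by (auto intro: replicate_eqI)
  next
    fix ps :: "nat list"
    assume "ps \<in> {replicate k 0}"
    then show "ps \<in> {ps. length ps = k \<and> P_position ps \<and> Max (set ps) = 0}"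
      using assms by (simp add: P_position_def nim_sum_replicate_0)
  qed
  then show ?thesis by (simp add: d_def)
qed

end

theory Submission
  imports Defs
begin

text \<open>Split the pile sizes below \<open>2 ^ b + c\<close> (with \<open>c \<le> 2 ^ b\<close>) into low ones, below \<open>2 ^ b\<close>, and
  high ones. Since a low pile realises every pattern of the lowest \<open>b\<close> bits exactly once, the
  positions with at least one low pile are equidistributed over the nim-sums with a given bit \<open>b\<close>,
  and that bit only records the parity of the number of high piles. If \<open>k\<close> is even, deleting bit \<open>b\<close> from all
  piles of a P-position that consists of high piles only gives a P-position with piles below \<open>c\<close>.
  This expresses the number of P-positions with piles below \<open>2 ^ b + c\<close> by the number of those
  with piles below \<open>c\<close>; the theorem is the difference of these identities at \<open>c\<close> and \<open>c - 1\<close>.\<close>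

unbundle bit_operations_syntax

definition nim_count :: "nat set \<Rightarrow> nat \<Rightarrow> nat \<Rightarrow> nat" where
  "nim_count S k v = card {ps. length ps = k \<and> set ps \<subseteq> S \<and> nim_sum ps = v}"

lemma nim_sum_Cons: "nim_sum (x # xs) = x XOR nim_sum xs"
  by (simp add: nim_sum_def)

lemma nim_count_0: "nim_count S 0 v = (if v = 0 then 1 else 0)"
proof -
  have "{ps. length ps = 0 \<and> set ps \<subseteq> S \<and> nim_sum ps = v} = (if v = 0 then {[]} else {})"
    by (auto simp: nim_sum_def)
  then show ?thesis
    by (simp add: nim_count_def)
qed

lemma xor_eq_iff_nat: "x XOR y = z \<longleftrightarrow> y = z XOR x" for x y z :: nat
  by (metis xor.assoc xor.commute xor_self_eq xor.left_neutral)

lemma nim_count_Suc: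
  assumes "finite S"
  shows "nim_count S (Suc k) v = (\<Sum>x\<in>S. nim_count S k (v XOR x))"
proof -
  let ?L = "\<lambda>k v. {ps. length ps = k \<and> set ps \<subseteq> S \<and> nim_sum ps = v}"
  have fin: "finite (?L k v)" for k v
    using finite_lists_length_eq[OF assms, of k] by (rule rev_finite_subset) auto
  have Cons_mem: "x # xs \<in> ?L (Suc k) v \<longleftrightarrow> x \<in> S \<and> xs \<in> ?L k (v XOR x)" for x xs
    by (simp add: nim_sum_Cons xor_eq_iff_nat conj_ac)
  have "?L (Suc k) v = (\<Union>x\<in>S. (#) x ` ?L k (v XOR x))"
  proof (rule set_eqI)
    fix ps
    show "ps \<in> ?L (Suc k) v \<longleftrightarrow> ps \<in> (\<Union>x\<in>S. (#) x ` ?L k (v XOR x))"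
    proof (cases ps)
      case (Cons x xs)
      then show ?thesis
        unfolding Cons Cons_mem by blast
    qed auto
  qed
  then have "card (?L (Suc k) v) = card (\<Union>x\<in>S. (#) x ` ?L k (v XOR x))"
    by simp
  also have "\<dots> = (\<Sum>x\<in>S. card ((#) x ` ?L k (v XOR x)))"
    using assms fin by (intro card_UN_disjoint) auto
  also have "\<dots> = (\<Sum>x\<in>S. card (?L k (v XOR x)))"
    by (intro sum.cong refl card_image) auto
  finally show ?thesis
    by (simp add: nim_count_def)
qed

lemma xor_less_pow2: "x < 2 ^ m \<Longrightarrow> y < 2 ^ m \<Longrightarrow> x XOR y < 2 ^ m" for x y :: nat
  by (simp flip: take_bit_nat_eq_self_iff)

text \<open>Below \<open>2 ^ Suc m\<close>, lying below \<open>2 ^ m\<close> means that bit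
  \<open>m\<close> is clear, and XOR adds that bit modulo 2.\<close>

lemma xor_less_pow2_iff:
  fixes x y :: nat
  assumes "x < 2 ^ Suc m" "y < 2 ^ Suc m"
  shows "x XOR y < 2 ^ m \<longleftrightarrow> (x < 2 ^ m \<longleftrightarrow> y < 2 ^ m)"
proof -
  have less_iff: "z < 2 ^ m \<longleftrightarrow> drop_bit m z = 0" for z :: nat
    by (simp add: drop_bit_eq_div div_eq_0_iff)
  have "drop_bit m x < 2" "drop_bit m y < 2"
    using assms by (auto simp: drop_bit_eq_div less_mult_imp_div_less)
  then have "drop_bit m x \<in> {0, 1}" "drop_bit m y \<in> {0, 1}"
    by auto
  then show ?thesis
    by (auto simp: less_iff)
qed

lemma pow2_add_eq_xor: "y < 2 ^ m \<Longrightarrow> 2 ^ m + y = 2 ^ m XOR y" for y :: nat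
  by (rule disjunctive_add_eq_xor)
     (metis and_exp_eq_0_iff_not_bit and.commute bit_take_bit_iff less_irrefl take_bit_nat_eq_self_iff)

text \<open>On numbers of \<open>b + 1\<close> bits this is -1 to the power of bit \<open>b\<close>,
  a character of the group under XOR.\<close>

definition bit_sign :: "nat \<Rightarrow> nat \<Rightarrow> real" where
  "bit_sign b v = (if v < 2 ^ b then 1 else -1)"

lemma bit_sign_xor:
  "x < 2 ^ Suc b \<Longrightarrow> y < 2 ^ Suc b \<Longrightarrow> bit_sign b (x XOR y) = bit_sign b x * bit_sign b y"
  by (auto simp: bit_sign_def xor_less_pow2_iff)

context
  fixes b c :: nat
  assumes c_le: "c \<le> 2 ^ b"
begin

lemma split_low_high: "{..<2 ^ b + c} = {..<2 ^ b} \<union> {2 ^ b..<2 ^ b + c}"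
  by auto

lemma sum_split_low_high:
  "(\<Sum>y<2 ^ b + c. f y) = (\<Sum>y<2 ^ b. f y) + (\<Sum>y\<in>{2 ^ b..<2 ^ b + c}. f y)"
  for f :: "nat \<Rightarrow> 'a::comm_monoid_add"
  unfolding split_low_high by (rule sum.union_disjoint) auto

text \<open>As \<open>x\<close> runs over the low piles, \<open>v XOR x\<close> takes each value
  that agrees with \<open>v\<close> in bit \<open>b\<close> exactly once. So the sum counts the
  \<open>k\<close>-tuples whose number of high piles has the parity given by bit \<open>b\<close> of
  \<open>v\<close>, with \<open>2 ^ b\<close> low and \<open>c\<close> high choices per
  pile.\<close>

lemma sum_low_nim_count:
  assumes "v < 2 ^ Suc b"
  shows "2 * (\<Sum>x<2 ^ b. real (nim_count {..<2 ^ b + c} k (v XOR x)))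
    = (2 ^ b + real c) ^ k + bit_sign b v * (2 ^ b - real c) ^ k"
  using assms
proof (induction k arbitrary: v)
  case 0
  have "(\<Sum>x<2 ^ b. real (nim_count {..<2 ^ b + c} 0 (v XOR x)))
      = (\<Sum>x<2 ^ b. if x = v then 1 else 0)"
    by (intro sum.cong refl) (auto simp: nim_count_0 xor_eq_iff_nat)
  also have "\<dots> = (if v < 2 ^ b then 1 else 0)"
    by (simp add: sum.delta)
  finally show ?case
    by (simp add: bit_sign_def)
next
  case (Suc k)
  let ?F = "\<lambda>v. \<Sum>x<2 ^ b. real (nim_count {..<2 ^ b + c} k (v XOR x))"
  let ?G = "\<lambda>s. (2 ^ b + real c) ^ k + bit_sign b v * s * (2 ^ b - real c) ^ k"
  have F: "2 * ?F (v XOR y) = ?G (bit_sign b y)" if "y < 2 ^ Suc b" for y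
    using Suc.IH[of "v XOR y"] Suc.prems that
    by (simp add: xor_less_pow2 bit_sign_xor del: power_Suc)
  have "(\<Sum>x<2 ^ b. real (nim_count {..<2 ^ b + c} (Suc k) (v XOR x)))
      = (\<Sum>x<2 ^ b. \<Sum>y<2 ^ b + c. real (nim_count {..<2 ^ b + c} k (v XOR x XOR y)))"
    by (simp add: nim_count_Suc xor.assoc)
  also have "\<dots> = (\<Sum>y<2 ^ b + c. ?F (v XOR y))"
    by (subst sum.swap) (simp add: ac_simps)
  finally have "2 * (\<Sum>x<2 ^ b. real (nim_count {..<2 ^ b + c} (Suc k) (v XOR x)))
      = (\<Sum>y<2 ^ b + c. 2 * ?F (v XOR y))"
    by (simp only: sum_distrib_left)
  \<comment> \<open>The low choices of \<open>y\<close> keep the sign of \<open>v\<close>; the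
    \<open>c\<close> high ones flip it.\<close>
  also have "\<dots> = (\<Sum>y<2 ^ b::nat. ?G 1) + (\<Sum>y\<in>{2 ^ b..<2 ^ b + c}. ?G (-1))"
    unfolding sum_split_low_high using c_le
    by (intro arg_cong2[where f = "(+)"] sum.cong refl; subst F) (auto simp: bit_sign_def)
  also have "\<dots> = (2 ^ b + real c) ^ Suc k + bit_sign b v * (2 ^ b - real c) ^ Suc k"
    by (simp add: algebra_simps)
  finally show ?case .
qed

text \<open>The difference counts tuples with at least one low pile. Equidistribution gives each of
  the \<open>2 ^ b\<close> nim-sums with the same bit \<open>b\<close> an equal share of the tuples
  of the right parity; the last term removes the \<open>c ^ k\<close> all-high tuples when
  \<open>k\<close> itself has that parity.\<close>

lemma nim_count_minus_high:
  assumes "v < 2 ^ Suc b"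
  shows "2 ^ Suc b * (real (nim_count {..<2 ^ b + c} k v) - real (nim_count {2 ^ b..<2 ^ b + c} k v))
    = (2 ^ b + real c) ^ k + bit_sign b v * (2 ^ b - real c) ^ k
      - (1 + bit_sign b v * (-1) ^ k) * real c ^ k"
  using assms
proof (induction k arbitrary: v)
  case 0
  show ?case
    by (simp add: nim_count_0)
next
  case (Suc k)
  let ?N = "\<lambda>v. real (nim_count {..<2 ^ b + c} k v)"
  let ?H = "\<lambda>v. real (nim_count {2 ^ b..<2 ^ b + c} k v)"
  let ?G = "(2 ^ b + real c) ^ k - bit_sign b v * (2 ^ b - real c) ^ k
      - (1 - bit_sign b v * (-1) ^ k) * real c ^ k"
  have diff: "2 ^ Suc b * (?N (v XOR y) - ?H (v XOR y)) = ?G" if "y \<in> {2 ^ b..<2 ^ b + c}" for y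
  proof -
    from that c_le have "y < 2 ^ Suc b" "bit_sign b y = -1"
      by (auto simp: bit_sign_def)
    then show ?thesis
      using Suc.IH[of "v XOR y"] Suc.prems
      by (simp add: xor_less_pow2 bit_sign_xor del: power_Suc)
  qed
  \<comment> \<open>After a low first pile the other piles are free; after a high one they must
    still include a low pile.\<close>
  have "real (nim_count {..<2 ^ b + c} (Suc k) v) - real (nim_count {2 ^ b..<2 ^ b + c} (Suc k) v)
      = (\<Sum>x<2 ^ b. ?N (v XOR x)) + (\<Sum>y\<in>{2 ^ b..<2 ^ b + c}. ?N (v XOR y) - ?H (v XOR y))"
    by (simp add: nim_count_Suc sum_split_low_high sum_subtractf)
  then have "2 ^ Suc b * (real (nim_count {..<2 ^ b + c} (Suc k) v)
        - real (nim_count {2 ^ b..<2 ^ b + c} (Suc k) v))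
      = 2 ^ b * (2 * (\<Sum>x<2 ^ b. ?N (v XOR x)))
        + (\<Sum>y\<in>{2 ^ b..<2 ^ b + c}. 2 ^ Suc b * (?N (v XOR y) - ?H (v XOR y)))"
    by (simp add: distrib_left sum_distrib_left mult.assoc mult.left_commute)
  also have "\<dots> = 2 ^ b * ((2 ^ b + real c) ^ k + bit_sign b v * (2 ^ b - real c) ^ k)
      + (\<Sum>y\<in>{2 ^ b..<2 ^ b + c}. ?G)"
    by (simp only: sum_low_nim_count[OF Suc.prems] diff cong: sum.cong)
  also have "\<dots> = (2 ^ b + real c) ^ Suc k + bit_sign b v * (2 ^ b - real c) ^ Suc k
      - (1 + bit_sign b v * (-1) ^ Suc k) * real c ^ Suc k"
    by (simp add: algebra_simps)
  finally show ?case .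
qed

text \<open>Deleting bit \<open>b\<close> from \<open>k\<close> high piles changes the nim-sum by
  \<open>2 ^ b\<close> exactly when \<open>k\<close> is odd.\<close>

lemma nim_count_high:
  "nim_count {2 ^ b..<2 ^ b + c} k v = nim_count {..<c} k (v XOR (if even k then 0 else 2 ^ b))"
proof (induction k arbitrary: v)
  case 0
  show ?case
    by (simp add: nim_count_0)
next
  case (Suc k)
  let ?e = "\<lambda>k. if even k then 0 else 2 ^ b :: nat"
  have cancel: "x XOR (x XOR y) = y" for x y :: nat
    by (simp flip: xor.assoc)
  have "nim_count {2 ^ b..<2 ^ b + c} (Suc k) v
      = (\<Sum>y\<in>(+) (2 ^ b) ` {..<c}. nim_count {..<c} k (v XOR y XOR ?e k))"
    unfolding nim_count_Suc[OF finite_atLeastLessThan] Suc.IH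
    by (simp add: lessThan_atLeast0 add.commute xor.assoc)
  also have "\<dots> = (\<Sum>y<c. nim_count {..<c} k (v XOR (2 ^ b + y) XOR ?e k))"
    by (subst sum.reindex) auto
  \<comment> \<open>As \<open>c \<le> 2 ^ b\<close>, bit \<open>b\<close> of \<open>y\<close> is
    clear, so adding \<open>2 ^ b\<close> is XOR and merges with the parity term.\<close>
  also have "\<dots> = (\<Sum>y<c. nim_count {..<c} k (v XOR ?e (Suc k) XOR y))"
    using c_le
    by (intro sum.cong refl)
       (auto simp: pow2_add_eq_xor xor.assoc xor.commute xor.left_commute cancel)
  finally show ?case
    by (simp add: nim_count_Suc xor.assoc)
qed

lemma nim_count_pow2_add:
  assumes "even k"
  shows "real (nim_count {..<2 ^ b + c} k 0)
    = ((2 ^ b + real c) ^ k + (2 ^ b - real c) ^ k - 2 * real c ^ k) / 2 ^ Suc b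
      + real (nim_count {..<c} k 0)"
  using nim_count_minus_high[of 0 k, unfolded nim_count_high] assms
  by (simp add: bit_sign_def field_simps)

end

lemma d_eq_nim_count_diff:
  assumes "k > 0"
  shows "real (d k m) = real (nim_count {..<Suc m} k 0) - real (nim_count {..<m} k 0)"
proof -
  let ?D = "{ps. length ps = k \<and> P_position ps \<and> Max (set ps) = m}"
  let ?L = "\<lambda>m. {ps. length ps = k \<and> set ps \<subseteq> {..<m} \<and> nim_sum ps = 0}"
  \<comment> \<open>Since \<open>k > 0\<close>, the list is nonempty and its maximum is
    attained.\<close>
  have "Max (set ps) \<in> set ps" if "length ps = k" for ps :: "nat list"
    using that assms by (intro Max_in) auto
  then have "?L (Suc m) = ?D \<union> ?L m"
    by (fastforce simp: P_position_def less_Suc_eq dest: Max_ge[OF finite_set]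
        intro: Max_eqI[OF finite_set])
  moreover have "finite (?L m)"
    using finite_lists_length_eq[of "{..<m}" k] by (rule rev_finite_subset) auto
  moreover have "?D \<inter> ?L m = {}"
    using \<open>\<And>ps. length ps = k \<Longrightarrow> Max (set ps) \<in> set ps\<close> by fastforce
  ultimately have "card (?L (Suc m)) = card ?D + card (?L m)"
    using finite_P_positions_Max[OF assms] by (simp add: card_Un_disjoint)
  then show ?thesis
    by (simp add: d_def nim_count_def)
qed

theorem theorem18:
  fixes k n b c :: nat
  assumes "even k" and "k > 0"
    and "n > 0"
    and "b = nat \<lfloor>log 2 (real n)\<rfloor>"
    and "c = n + 1 - 2 ^ b"
  shows "real (d k n) =
    ((2 ^ b + real c) ^ k + (2 ^ b - real c) ^ k
      - (2 ^ b + real c - 1) ^ k - (2 ^ b - real c + 1) ^ k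
      - 2 * real c ^ k + 2 * (real c - 1) ^ k) / 2 ^ (b + 1)
    + real (d k (c - 1))"
proof -
  have "\<lfloor>log 2 (real n)\<rfloor> = int b"
    using assms(3,4) by simp
  then have "2 ^ b \<le> n" "n < 2 ^ Suc b"
    using floor_log_nat_eq_powr_iff[of 2 n b] assms(3) by auto
  \<comment> \<open>Here \<open>a = c - 1\<close> is the offset of \<open>n\<close> from
    \<open>2 ^ b\<close>: piles at most \<open>n\<close> are those below \<open>2 ^ b + c\<close>,
    piles below \<open>n\<close> those below \<open>2 ^ b + a\<close>. Both offsets are at most
    \<open>2 ^ b\<close>, as \<open>nim_count_pow2_add\<close> requires.\<close>
  with assms(5) obtain a where a: "c = Suc a" "n = 2 ^ b + a" "Suc a \<le> 2 ^ b"
    by (cases c) (auto simp: that[of "n - 2 ^ b"])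
  have "real (d k n) = real (nim_count {..<2 ^ b + c} k 0) - real (nim_count {..<2 ^ b + a} k 0)"
    using a d_eq_nim_count_diff[OF assms(2), of n] by simp
  also have "\<dots> = ((2 ^ b + real c) ^ k + (2 ^ b - real c) ^ k - 2 * real c ^ k) / 2 ^ Suc b
      - ((2 ^ b + real a) ^ k + (2 ^ b - real a) ^ k - 2 * real a ^ k) / 2 ^ Suc b
      + (real (nim_count {..<c} k 0) - real (nim_count {..<a} k 0))"
    using a(1,3) assms(1) by (subst (1 2) nim_count_pow2_add) auto
  also have "real (nim_count {..<c} k 0) - real (nim_count {..<a} k 0) = real (d k (c - 1))"
    using a d_eq_nim_count_diff[OF assms(2), of a] by simp
  also have "real a = real c - 1"
    using a by simp
  finally show ?thesis
    by (simp add: add_divide_distrib diff_divide_distrib algebra_simps)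
qed

end
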